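(* Let $\boldsymbol X_1,\ldots,\boldsymbol X_n\in\mathbb R^d$, let $[n]=\{1,\ldots,n\}$, let $$\mathcal Q:=\{(\psi(\boldsymbol X_1),\ldots,\psi(\boldsymbol X_n)):\ \psi:\mathbb R^d\to\mathbb R\text{ quasiconvex and decreasing}\}\subseteq\mathbb R^n,$$ and let $$\mathcal L(\mathcal X):=\{(i,S):\ i\in[n],\ S\subseteq[n],\ \boldsymbol X_i\in\mathrm{Cv}^\dagger(\{\boldsymbol X_j:j\in S\})\}.$$ Then $$\mathcal Q=\Big\{\boldsymbol z\in\mathbb R^n:\ z_i\le\max_{j\in S}z_j\ \text{ for all }(i,S)\in\mathcal L(\mathcal X)\Big\}.$$
   Context: For $\boldsymbol a,\boldsymbol b\in\mathbb R^d$, $\boldsymbol a\le\boldsymbol b$ means $a_i\le b_i$ for all $i$. $\psi:\mathbb R^d\to\mathbb R$ is quasiconvex if $\psi(\lambda\boldsymbol x+(1-\lambda)\boldsymbol y)\le\max\{\psi(\boldsymbol x),\psi(\boldsymbol y)\}$ for all $\boldsymbol x,\boldsymbol y$ and $\lambda\in[0,1]$, and decreasing if $\psi(\boldsymbol x)\ge\psi(\boldsymbol y)$ whenever $\boldsymbol x\le\boldsymbol y$. For $A\subseteq\mathbb R^d$, $\mathrm{Cv}(A)$ is its convex hull (with $\mathrm{Cv}(\emptyset)=\emptyset$) and $\mathrm{Cv}^\dagger(A):=\{\boldsymbol y\in\mathbb R^d:\ \boldsymbol x\le\boldsymbol y\text{ for some }\boldsymbol x\in\mathrm{Cv}(A)\}$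 is the upper orthant of the convex hull. *)

theory Defs
  imports "HOL-Analysis.Analysis"
begin

(* The order \<le> on real ^ 'd is the componentwise one, so antimono is "decreasing" with
   respect to it. *)

definition quasiconvex :: "('a::real_vector \<Rightarrow> real) \<Rightarrow> bool" where
  "quasiconvex \<psi> \<longleftrightarrow>
     (\<forall>x y. \<forall>t\<in>{0..1}. \<psi> (t *\<^sub>R x + (1 - t) *\<^sub>R y) \<le> max (\<psi> x) (\<psi> y))"

definition upper_orthant_hull :: "(real ^ 'd) set \<Rightarrow> (real ^ 'd) set" where
  "upper_orthant_hull A = {y. \<exists>x \<in> convex hull A. x \<le> y}"

definition realizable_values :: "('n::finite \<Rightarrow> real ^ 'd) \<Rightarrow> (real ^ 'n) set" where
  "realizable_values X = {(\<chi> i. \<psi> (X i)) | \<psi>. quasiconvex \<psi> \<and> antimono \<psi>}"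

definition hull_incidences :: "('n::finite \<Rightarrow> real ^ 'd) \<Rightarrow> ('n \<times> 'n set) set" where
  "hull_incidences X = {(i, S). X i \<in> upper_orthant_hull (X ` S)}"

(* Max {} is unspecified, but S is never empty in the intended use: the convex hull of {} is
   empty, hence so is its upper orthant. *)
lemma hull_incidences_nonempty: "(i, S) \<in> hull_incidences X \<Longrightarrow> S \<noteq> {}"
  by (auto simp: hull_incidences_def upper_orthant_hull_def)

end

theory Submission
  imports Defs
begin

text \<open>
  Writing \<open>U c\<close> for the upper orthant hull of the points \<open>X j\<close> with \<open>z j \<le> c\<close>, a vector \<open>z\<close> that
  satisfies the inequalities is realized by the function with sublevel sets \<open>U c\<close>, that is, by
  sending \<open>x\<close> to the least value \<open>c\<close> of \<open>z\<close> with \<open>x \<in> U c\<close>, and to the largest value of \<open>z\<close> if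
  there is none. Since every \<open>U c\<close> is convex and upward closed, this function is quasiconvex and
  decreasing. The inequality for \<open>(i, {j. z j \<le> c})\<close> says that \<open>X i \<in> U c\<close> forces \<open>z i \<le> c\<close>.
\<close>

lemma quasiconvex_convex_sublevel:
  assumes "quasiconvex \<psi>"
  shows "convex {x. \<psi> x \<le> c}"
  unfolding convex_alt
proof clarsimp
  fix x y and u :: real
  assume *: "\<psi> x \<le> c" "\<psi> y \<le> c" "0 \<le> u" "u \<le> 1"
  \<comment> \<open>\<open>convex_alt\<close> puts the weight \<open>u\<close> on the second point,
    \<open>quasiconvex\<close> puts it on the first; hence the swap of \<open>x\<close> and
    \<open>y\<close>.\<close>
  then have "\<psi> (u *\<^sub>R y + (1 - u) *\<^sub>R x) \<le> max (\<psi> y) (\<psi> x)"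
    using assms by (auto simp: quasiconvex_def)
  then show "\<psi> ((1 - u) *\<^sub>R x + u *\<^sub>R y) \<le> c"
    using * by (simp add: add.commute)
qed

text \<open>The sublevel set of \<psi> at the maximum over \<open>A\<close> is convex and contains
  \<open>A\<close>, so it contains the hull; going up from the hull only lowers \<psi>. This shows
  that realizable vectors satisfy the inequalities.\<close>

lemma quasiconvex_antimono_le_Max:
  assumes \<psi>: "quasiconvex \<psi>" "antimono \<psi>"
    and "finite A" and y: "y \<in> upper_orthant_hull A"
  shows "\<psi> y \<le> Max (\<psi> ` A)"
proof -
  obtain x where x: "x \<in> convex hull A" "x \<le> y"
    using y by (auto simp: upper_orthant_hull_def)
  have "convex hull A \<subseteq> {x. \<psi> x \<le> Max (\<psi> ` A)}"
    using quasiconvex_convex_sublevel[OF \<psi>(1)] \<open>finite A\<close> by (intro hull_minimal) auto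
  then have "\<psi> x \<le> Max (\<psi> ` A)"
    using x(1) by blast
  then show ?thesis
    using antimonoD[OF \<psi>(2) x(2)] by linarith
qed

lemma upper_orthant_hull_superset: "A \<subseteq> upper_orthant_hull A"
  unfolding upper_orthant_hull_def using hull_subset[of A convex] by auto

lemma upper_orthant_hull_mono: "A \<subseteq> B \<Longrightarrow> upper_orthant_hull A \<subseteq> upper_orthant_hull B"
  unfolding upper_orthant_hull_def using hull_mono[of A B convex] by auto

lemma upper_orthant_hull_upward_closed:
  "x \<in> upper_orthant_hull A \<Longrightarrow> x \<le> y \<Longrightarrow> y \<in> upper_orthant_hull A"
  unfolding upper_orthant_hull_def using order_trans by blast

lemma convex_upper_orthant_hull: "convex (upper_orthant_hull A)"
proof (rule convexI)
  fix x y and u v :: real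
  assume "x \<in> upper_orthant_hull A" "y \<in> upper_orthant_hull A" and uv: "0 \<le> u" "0 \<le> v" "u + v = 1"
  then obtain x' y' where "x' \<in> convex hull A" "x' \<le> x" "y' \<in> convex hull A" "y' \<le> y"
    by (auto simp: upper_orthant_hull_def)
  then have "u *\<^sub>R x' + v *\<^sub>R y' \<in> convex hull A" "u *\<^sub>R x' + v *\<^sub>R y' \<le> u *\<^sub>R x + v *\<^sub>R y"
    using uv by (auto intro!: convexD[OF convex_convex_hull] add_mono scaleR_left_mono)
  then show "u *\<^sub>R x + v *\<^sub>R y \<in> upper_orthant_hull A"
    by (auto simp: upper_orthant_hull_def)
qed

text \<open>Restricting to values of \<open>z\<close> makes the set finite. Admitting the largest
  value at every \<open>x\<close> makes it nonempty, so that its minimum exists even at points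
  outside all the hulls.\<close>

definition attained_levels :: "('n::finite \<Rightarrow> real ^ 'd) \<Rightarrow> real ^ 'n \<Rightarrow> real ^ 'd \<Rightarrow> real set" where
  "attained_levels X z x =
     {c \<in> range (($) z). c = Max (range (($) z)) \<or> x \<in> upper_orthant_hull (X ` {j. z $ j \<le> c})}"

definition level_function :: "('n::finite \<Rightarrow> real ^ 'd) \<Rightarrow> real ^ 'n \<Rightarrow> real ^ 'd \<Rightarrow> real" where
  "level_function X z x = Min (attained_levels X z x)"

lemma finite_attained_levels: "finite (attained_levels X z x)"
  by (simp add: attained_levels_def)

lemma attained_levels_nonempty: "attained_levels X z x \<noteq> {}"
proof -
  have "Max (range (($) z)) \<in> attained_levels X z x"
    unfolding attained_levels_def by (simp add: Max_in)
  then show ?thesis by blast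
qed

lemma level_function_in: "level_function X z x \<in> attained_levels X z x"
  unfolding level_function_def by (rule Min_in[OF finite_attained_levels attained_levels_nonempty])

lemma level_function_le: "c \<in> attained_levels X z x \<Longrightarrow> level_function X z x \<le> c"
  unfolding level_function_def by (rule Min_le[OF finite_attained_levels])

lemma attained_levels_upward_closed:
  assumes "c \<in> attained_levels X z x" "c \<le> c'" "c' \<in> range (($) z)"
  shows "c' \<in> attained_levels X z x"
proof (cases "c = Max (range (($) z))")
  case True
  \<comment> \<open>The top level may be present by convention only, without membership in a hull,
    but no value of \<open>z\<close> lies above it.\<close>
  have "c' \<le> Max (range (($) z))"
    using assms(3) by (intro Max_ge) auto
  then have "c' = c"
    using True assms(2) by linarith
  then show ?thesis
    using assms(1) by simp
next
  case False
  have "upper_orthant_hull (X ` {j. z $ j \<le> c}) \<subseteq> upper_orthant_hull (X ` {j. z $ j \<le> c'})"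
    using assms(2) by (intro upper_orthant_hull_mono) auto
  then show ?thesis
    using False assms by (auto simp: attained_levels_def)
qed

text \<open>The larger of the two minimal levels is again a value of \<open>z\<close> and is
  attained at both endpoints. Convexity of the hull at that level carries it over to the segment
  between them.\<close>

lemma quasiconvex_level_function: "quasiconvex (level_function X z)"
  unfolding quasiconvex_def
proof (intro allI ballI)
  fix x y and t :: real
  assume t: "t \<in> {0..1}"
  let ?m = "max (level_function X z x) (level_function X z y)"
  have "?m \<in> range (($) z)"
    using level_function_in[of X z x] level_function_in[of X z y]
    by (auto simp: attained_levels_def max_def)
  then have "?m \<in> attained_levels X z x" "?m \<in> attained_levels X z y"
    by (auto intro: attained_levels_upward_closed[OF level_function_in])
  then have "?m \<in> attained_levels X z (t *\<^sub>R x + (1 - t) *\<^sub>R y)"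
    using t convexD[OF convex_upper_orthant_hull, of x _ y t "1 - t"]
    unfolding attained_levels_def by auto
  then show "level_function X z (t *\<^sub>R x + (1 - t) *\<^sub>R y) \<le> ?m"
    by (rule level_function_le)
qed

text \<open>Moving up can only add attained levels, which can only lower their minimum.\<close>

lemma antimono_level_function:
  fixes X :: "'n::finite \<Rightarrow> real ^ 'd"
  shows "antimono (level_function X z)"
proof (rule antimonoI)
  fix x y :: "real ^ 'd"
  assume "x \<le> y"
  then have "attained_levels X z x \<subseteq> attained_levels X z y"
    by (auto simp: attained_levels_def intro: upper_orthant_hull_upward_closed)
  then show "level_function X z y \<le> level_function X z x"
    using level_function_in level_function_le by blast
qed

lemma level_function_interpolates:
  assumes z: "\<And>i S. (i, S) \<in> hull_incidences X \<Longrightarrow> z $ i \<le> Max ((\<lambda>j. z $ j) ` S)"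
  shows "level_function X z (X i) = z $ i"
proof (rule antisym)
  \<comment> \<open>The index \<open>i\<close> itself satisfies \<open>z $ j \<le> z $ i\<close>, so
    this bound holds for every \<open>z\<close>.\<close>
  have "X i \<in> upper_orthant_hull (X ` {j. z $ j \<le> z $ i})"
    using upper_orthant_hull_superset by fastforce
  then show "level_function X z (X i) \<le> z $ i"
    by (intro level_function_le) (simp add: attained_levels_def)
next
  let ?c = "level_function X z (X i)"
  consider "?c = Max (range (($) z))" | "X i \<in> upper_orthant_hull (X ` {j. z $ j \<le> ?c})"
    using level_function_in[of X z "X i"] by (auto simp: attained_levels_def)
  then show "z $ i \<le> ?c"
  proof cases
    case 1
    then show ?thesis by simp
  next
    case 2
    then have inc: "(i, {j. z $ j \<le> ?c}) \<in> hull_incidences X"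
      by (simp add: hull_incidences_def)
    \<comment> \<open>The incidence guarantees that this index set is nonempty, so
      \<open>Max\<close> is a genuine maximum here.\<close>
    have "Max ((\<lambda>j. z $ j) ` {j. z $ j \<le> ?c}) \<le> ?c"
      using hull_incidences_nonempty[OF inc] by (intro Max.boundedI) auto
    then show ?thesis
      using z[OF inc] by linarith
  qed
qed

theorem lemma3p2:
  fixes X :: "'n::finite \<Rightarrow> real ^ 'd"
  shows "realizable_values X =
    {z :: real ^ 'n. \<forall>(i, S) \<in> hull_incidences X. z $ i \<le> Max ((\<lambda>j. z $ j) ` S)}"
proof (intro equalityI subsetI)
  fix z assume "z \<in> realizable_values X"
  then obtain \<psi> where \<psi>: "quasiconvex \<psi>" "antimono \<psi>" and z: "z = (\<chi> i. \<psi> (X i))"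
    by (auto simp: realizable_values_def)
  have "z $ i \<le> Max ((\<lambda>j. z $ j) ` S)" if "(i, S) \<in> hull_incidences X" for i S
    using quasiconvex_antimono_le_Max[OF \<psi>, of "X ` S" "X i"] that
    by (simp add: z hull_incidences_def image_image)
  then show "z \<in> {z. \<forall>(i, S) \<in> hull_incidences X. z $ i \<le> Max ((\<lambda>j. z $ j) ` S)}"
    by auto
next
  fix z :: "real ^ 'n"
  assume "z \<in> {z. \<forall>(i, S) \<in> hull_incidences X. z $ i \<le> Max ((\<lambda>j. z $ j) ` S)}"
  then have "z = (\<chi> i. level_function X z (X i))"
    by (subst level_function_interpolates) auto
  then show "z \<in> realizable_values X"
    unfolding realizable_values_def
    using quasiconvex_level_function antimono_level_function by blast
qed

end
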